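(* Let $C\subset\mathbb E^d$ be compact and convex, and let $B\subset C$ be compact with positive measure. Then (i) implies (ii), where the claims (i) and (ii) are as follows: (i) $B$ has maximum measure amongst all its affine images contained in $C$. (ii) There are $u_k\in B\cap \operatorname{bd} C$, $v_k\in N_C(u_k)$, and real numbers $\lambda_k>0$, $k=1,\dots,n$, where $d+1\le n\le d(d+1)$, such that $$I=\sum_{k=1}^n \lambda_k\, u_k\otimes v_k,\qquad o=\sum_{k=1}^n \lambda_k\, v_k.$$
   Context: $\mathbb E^d$ is Euclidean $d$-space, with origin $o$ and inner product $\cdot$. Measure means $d$-dimensional Lebesgue measure. $I$ is the $d\times d$ unit (identity) matrix. For $u,v\in\mathbb E^d$ (column vectors), $u\otimes v$ denotes the $d\times d$ matrix $u\,v^T$. $\operatorname{bd} C$ is the boundary of $C$. For $u\in\operatorname{bd} C$, $N_C(u)=\{v\in\mathbb E^d: v\cdot(x-u)\le 0 \text{ for all } x\in C\}$ is the normal cone of $C$ at $u$. An affine image of $B$ is a set $MB+a$ with $M$ a non-singular real $d\times d$ matrix and $a\in\mathbb E^d$. *)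

theory Defs
  imports "HOL-Analysis.Analysis"
begin

definition tensor_vec :: "real ^ 'n \<Rightarrow> real ^ 'n \<Rightarrow> real ^ 'n ^ 'n" where
  "tensor_vec u v = (columnvector u :: real ^ 1 ^ 'n) ** (rowvector v :: real ^ 'n ^ 1)"

lemma tensor_vec_nth: "tensor_vec u v $ i $ j = u $ i * v $ j"
  by (simp add: tensor_vec_def columnvector_def rowvector_def matrix_matrix_mult_def)

definition normal_cone :: "(real ^ 'n) set \<Rightarrow> real ^ 'n \<Rightarrow> (real ^ 'n) set" where
  "normal_cone C u = {v. \<forall>x\<in>C. v \<bullet> (x - u) \<le> 0}"

definition affine_images :: "(real ^ 'n) set \<Rightarrow> (real ^ 'n) set set" where
  "affine_images B = {(\<lambda>x. M *v x + a) ` B | M a. invertible M}"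

end

theory Submission
  imports Defs
begin

text \<open>
  If \<open>(I, o)\<close> is not in the convex cone generated by the pairs \<open>(u \<otimes> v, v)\<close>, where \<open>v\<close> is a unit
  normal of \<open>C\<close> at \<open>u \<in> B\<close>, then a separating hyperplane provides a matrix \<open>A\<close> of positive trace
  and a vector \<open>b\<close> such that the field \<open>x \<mapsto> Ax + b\<close> points strictly into \<open>C\<close> at each point of \<open>B\<close>.
  For small \<open>t > 0\<close> the affine map \<open>x \<mapsto> x + t(Ax + b)\<close> then sends \<open>B\<close> into \<open>C\<close> and has determinant
  larger than 1, against the maximality of \<open>B\<close>. The bound \<open>n \<le> d(d + 1)\<close> is Caratheodory's theorem
  for cones in dimension \<open>d\<^sup>2 + d\<close>; for the lower bound, the \<open>v\<^sub>k\<close> span the space and satisfy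
  a linear relation with positive coefficients.
\<close>

section \<open>Convex cones\<close>

text \<open>Caratheodory's reduction for cones. While \<open>T\<close> is dependent, a multiple of a
  linear relation can be subtracted from the coefficients until the first of them vanishes; the
  others stay nonnegative, and the vanishing term is discarded.\<close>

lemma positive_combination_independent:
  fixes c :: "'a::euclidean_space \<Rightarrow> real"
  assumes "finite T" "\<And>x. x \<in> T \<Longrightarrow> 0 \<le> c x"
  shows "\<exists>S b. S \<subseteq> T \<and> independent S \<and> (\<forall>x\<in>S. 0 < b x)
               \<and> (\<Sum>x\<in>S. b x *\<^sub>R x) = (\<Sum>x\<in>T. c x *\<^sub>R x)"
  using assms
proof (induction "card T" arbitrary: T c rule: less_induct)
  case less
  \<comment> \<open>Any representation of the same vector with nonnegative coefficients, one of them
    zero, reduces to a smaller set. This serves for a zero already present in \<open>c\<close> and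
    for one produced by a relation.\<close>
  have drop: ?case
    if x0: "x0 \<in> T" "c' x0 = 0" and c': "\<And>x. x \<in> T \<Longrightarrow> 0 \<le> c' x"
      and eq: "(\<Sum>x\<in>T. c' x *\<^sub>R x) = (\<Sum>x\<in>T. c x *\<^sub>R x)" for x0 c'
  proof -
    have "card (T - {x0}) < card T"
      using less.prems x0 by (meson card_Diff1_less)
    then obtain S b where "S \<subseteq> T - {x0}" "independent S" "\<forall>x\<in>S. 0 < b x"
      "(\<Sum>x\<in>S. b x *\<^sub>R x) = (\<Sum>x\<in>T - {x0}. c' x *\<^sub>R x)"
      using less.hyps[of "T - {x0}" c'] less.prems c' by auto
    moreover have "(\<Sum>x\<in>T. c' x *\<^sub>R x) = (\<Sum>x\<in>T - {x0}. c' x *\<^sub>R x)"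
      using x0 less.prems by (simp add: sum.remove)
    ultimately show ?thesis
      using eq by (intro exI[of _ S] exI[of _ b]) auto
  qed
  show ?case
  proof (cases "\<exists>x0\<in>T. c x0 = 0")
    case True
    then show ?thesis using drop less.prems by blast
  next
    case False
    then have pos: "0 < c x" if "x \<in> T" for x
      using less.prems(2) that by (metis order_le_less)
    show ?thesis
    proof (cases "independent T")
      case True
      then show ?thesis using pos by blast
    next
      case False
      then obtain u0 v where v: "v \<in> T" "u0 v \<noteq> 0" and u0: "(\<Sum>x\<in>T. u0 x *\<^sub>R x) = 0"
        using dependent_finite[OF less.prems(1)] by auto
      \<comment> \<open>A relation may be negated, so some coefficient can be taken positive; this
        makes the set \<open>P\<close> below nonempty.\<close>
      obtain u where u: "(\<Sum>x\<in>T. u x *\<^sub>R x) = 0" and uv: "0 < u v"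
      proof (cases "u0 v > 0")
        case True
        with u0 show ?thesis by (rule that)
      next
        case False
        then show ?thesis
          using that[of "\<lambda>x. - u0 x"] u0 v by (simp add: sum_negf)
      qed
      define P where "P = {x \<in> T. 0 < u x}"
      \<comment> \<open>The largest \<open>t\<close> for which all \<open>c x - t * u x\<close>
        remain nonnegative; the coefficient vanishes where the minimum is attained.\<close>
      define t where "t = Min ((\<lambda>x. c x / u x) ` P)"
      have P: "finite P" "P \<noteq> {}"
        using less.prems v uv by (auto simp: P_def)
      then have "t \<in> (\<lambda>x. c x / u x) ` P"
        unfolding t_def by (intro Min_in) auto
      then obtain x0 where x0: "x0 \<in> P" "t = c x0 / u x0" by auto
      have le: "t \<le> c x / u x" if "x \<in> P" for x
        unfolding t_def using P that by (intro Min_le) auto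
      have t0: "0 < t"
        using x0 pos by (auto simp: P_def)
      show ?thesis
      proof (rule drop[of x0 "\<lambda>x. c x - t * u x"])
        show "x0 \<in> T" "c x0 - t * u x0 = 0"
          using x0 by (auto simp: P_def)
        show "0 \<le> c x - t * u x" if "x \<in> T" for x
        proof (cases "0 < u x")
          case True
          then show ?thesis using le[of x] that by (simp add: P_def field_simps)
        next
          case False
          then have "t * u x \<le> 0" using t0 by (simp add: mult_le_0_iff)
          then show ?thesis using pos[OF that] by simp
        qed
        show "(\<Sum>x\<in>T. (c x - t * u x) *\<^sub>R x) = (\<Sum>x\<in>T. c x *\<^sub>R x)"
          using u by (simp add: scaleR_diff_left sum_subtractf flip: scaleR_scaleR scaleR_sum_right)
      qed
    qed
  qed
qed

text \<open>A Farkas alternative with strict inequalities. If the ray through \<open>z\<close> meets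
  the compact hull, scaling gives a cone representation of \<open>z\<close>. Otherwise a hyperplane
  strictly separates hull and ray, and a small tilt towards \<open>z\<close> makes the inequality at
  \<open>z\<close> strict as well.\<close>

lemma compact_cone_alternative:
  fixes S :: "'a::euclidean_space set"
  assumes S: "compact S" and S0: "0 \<notin> convex hull S" and z: "z \<noteq> 0"
  obtains (cone) T c where "finite T" "T \<subseteq> S" "\<And>x. x \<in> T \<Longrightarrow> 0 \<le> c x" "(\<Sum>x\<in>T. c x *\<^sub>R x) = z"
  | (separated) a where "a \<bullet> z > 0" "\<And>x. x \<in> S \<Longrightarrow> a \<bullet> x < 0"
proof (cases "\<exists>t\<ge>0. t *\<^sub>R z \<in> convex hull S")
  case True
  then obtain t where t: "t \<ge> 0" "t *\<^sub>R z \<in> convex hull S" by auto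
  with S0 have "t > 0" by (metis order_le_less scale_zero_left)
  obtain T u where T: "finite T" "T \<subseteq> S" "\<forall>x\<in>T. 0 \<le> u x" "(\<Sum>x\<in>T. u x *\<^sub>R x) = t *\<^sub>R z"
    using t(2) unfolding convex_hull_explicit by auto
  have "(\<Sum>x\<in>T. (u x / t) *\<^sub>R x) = (1 / t) *\<^sub>R (\<Sum>x\<in>T. u x *\<^sub>R x)"
    by (simp add: scaleR_sum_right)
  also have "\<dots> = z" using T \<open>t > 0\<close> by simp
  finally show ?thesis
    using cone[of T "\<lambda>x. u x / t"] T \<open>t > 0\<close> by auto
next
  case False
  show ?thesis
  proof (cases "S = {}")
    case True
    then show ?thesis using separated[of z] z by auto
  next
    case ne: False
    \<comment> \<open>The ray contains the origin, which forces the separating level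
      \<open>c\<close> to be negative.\<close>
    define R where "R = (\<lambda>t. t *\<^sub>R z) ` {0..}"
    have "convex R"
      unfolding R_def by (intro convex_linear_image linear_scaleR_left) auto
    moreover have "closed R"
      unfolding R_def using z by (intro closed_injective_linear_image) (auto simp: inj_on_def)
    moreover have "convex hull S \<inter> R = {}"
      using False by (auto simp: R_def)
    ultimately obtain a c where a: "\<And>x. x \<in> convex hull S \<Longrightarrow> a \<bullet> x < c" "\<And>x. x \<in> R \<Longrightarrow> c < a \<bullet> x"
      using separating_hyperplane_compact_closed[of "convex hull S" R] S ne
      by (metis compact_convex_hull convex_convex_hull convex_hull_eq_empty)
    have ray: "c < t * (a \<bullet> z)" if "t \<ge> 0" for t
      using a(2)[of "t *\<^sub>R z"] that by (force simp: R_def)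
    have c: "c < 0" using ray[of 0] by simp
    have az: "a \<bullet> z \<ge> 0"
    proof (rule ccontr)
      assume "\<not> a \<bullet> z \<ge> 0"
      then show False using ray[of "c / (a \<bullet> z)"] c by (simp add: divide_nonpos_neg)
    qed
    obtain K where K: "\<And>x. x \<in> S \<Longrightarrow> norm x \<le> K" "K > 0"
      using compact_imp_bounded[OF S] bounded_pos by metis
    \<comment> \<open>Adding \<open>e *\<^sub>R z\<close> changes the functional on \<open>S\<close>
      by at most \<open>e * (K * norm z)\<close>; the \<open>+ 1\<close> keeps this strictly below
      the gap \<open>- c\<close>.\<close>
    define e where "e = - c / (K * norm z + 1)"
    have den: "K * norm z + 1 > 0"
      using K(2) by (simp add: add_nonneg_pos)
    have e: "e > 0" using c den by (simp add: e_def divide_neg_pos)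
    show ?thesis
    proof (rule separated[of "a + e *\<^sub>R z"])
      show "(a + e *\<^sub>R z) \<bullet> z > 0"
        using az e z by (simp add: inner_add_left add_nonneg_pos)
    next
      fix x assume x: "x \<in> S"
      have "z \<bullet> x \<le> norm z * norm x" by (rule norm_cauchy_schwarz)
      also have "\<dots> \<le> K * norm z" using K(1)[OF x] by (metis mult.commute mult_left_mono norm_ge_zero)
      finally have "e * (z \<bullet> x) \<le> e * (K * norm z)" using e by simp
      also have "\<dots> < e * (K * norm z + 1)" using e by simp
      also have "\<dots> = - c" using den by (simp add: e_def)
      finally show "(a + e *\<^sub>R z) \<bullet> x < 0"
        using a(1)[of x] x by (simp add: inner_add_left hull_inc)
    qed
  qed
qed

section \<open>Normal cones and inward fields\<close>

text \<open>From an interior point \<open>p\<close> one can still move a little in direction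
  \<open>v\<close> inside \<open>C\<close>, which strictly increases the inner product with
  \<open>v\<close>.\<close>

lemma normal_cone_interior_less:
  assumes "v \<in> normal_cone C u" "v \<noteq> 0" "p \<in> interior C"
  shows "v \<bullet> (p - u) < 0"
proof -
  obtain e where e: "e > 0" "cball p e \<subseteq> C"
    using assms(3) mem_interior_cball by blast
  have "p + (e / norm v) *\<^sub>R v \<in> C"
    using e assms(2) by (intro subsetD[OF e(2)]) (simp add: dist_norm)
  then have "v \<bullet> (p + (e / norm v) *\<^sub>R v - u) \<le> 0"
    using assms(1) by (auto simp: normal_cone_def)
  then have "v \<bullet> (p - u) + (e / norm v) * (v \<bullet> v) \<le> 0"
    by (simp add: inner_diff_right inner_add_right)
  moreover have "(e / norm v) * (v \<bullet> v) > 0"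
    using e assms(2) by simp
  ultimately show ?thesis by linarith
qed

lemma normal_cone_frontier:
  assumes "v \<in> normal_cone C u" "v \<noteq> 0" "u \<in> C"
  shows "u \<in> frontier C"
proof -
  have "u \<notin> interior C"
    using normal_cone_interior_less[OF assms(1,2), of u] by auto
  then show ?thesis
    using assms(3) closure_subset[of C] by (auto simp: frontier_def)
qed

text \<open>If the open ray from \<open>u\<close> along \<open>w\<close> missed the interior, a
  hyperplane separating the two would support \<open>C\<close> at \<open>u\<close>. Its normal would
  be a nonzero element of the normal cone making a nonnegative product with
  \<open>w\<close>.\<close>

lemma inward_direction_hits_interior:
  fixes C :: "(real ^ 'n) set"
  assumes C: "convex C" "interior C \<noteq> {}" and u: "u \<in> C"
    and w: "\<And>v. v \<in> normal_cone C u \<Longrightarrow> v \<noteq> 0 \<Longrightarrow> v \<bullet> w < 0"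
  obtains s where "s > 0" "u + s *\<^sub>R w \<in> interior C"
proof (rule ccontr)
  assume nt: "\<not> thesis"
  define R where "R = (\<lambda>s. u + s *\<^sub>R w) ` {0<..}"
  have "R = (+) u ` (\<lambda>s. s *\<^sub>R w) ` {0<..}"
    by (auto simp: R_def)
  then have "convex R"
    by (simp add: convex_translation convex_linear_image)
  moreover have "interior C \<inter> R = {}"
    using nt that by (auto simp: R_def)
  moreover have "R \<noteq> {}" by (auto simp: R_def)
  ultimately obtain a b where a: "a \<noteq> 0" "\<And>x. x \<in> interior C \<Longrightarrow> a \<bullet> x \<le> b" "\<And>x. x \<in> R \<Longrightarrow> b \<le> a \<bullet> x"
    using separating_hyperplane_sets[of "interior C" R] C by (metis convex_interior)
  \<comment> \<open>A convex set with nonempty interior lies in the closure of that interior, so the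
    bound extends to all of \<open>C\<close>.\<close>
  have Cb: "a \<bullet> x \<le> b" if "x \<in> C" for x
  proof -
    have "closure (interior C) \<subseteq> {x. a \<bullet> x \<le> b}"
      using a(2) by (intro closure_minimal closed_halfspace_le) auto
    then show ?thesis
      using convex_closure_interior[OF C] closure_subset[of C] that by auto
  qed
  have Rb: "b \<le> a \<bullet> u + s * (a \<bullet> w)" if "s > 0" for s
    using a(3)[of "u + s *\<^sub>R w"] that by (auto simp: R_def inner_add_right)
  \<comment> \<open>Letting \<open>s\<close> tend to 0 places \<open>u\<close> itself on the
    hyperplane.\<close>
  have "((\<lambda>s. a \<bullet> u + s * (a \<bullet> w)) \<longlongrightarrow> a \<bullet> u + 0 * (a \<bullet> w)) (at_right 0)"
    by (intro tendsto_intros)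
  then have bu: "b \<le> a \<bullet> u"
    using Rb by (intro tendsto_lowerbound[where F = "at_right 0" and f = "\<lambda>s. a \<bullet> u + s * (a \<bullet> w)"])
      (auto simp: eventually_at_right_less intro: eventually_mono[OF eventually_at_right_less])
  have "a \<in> normal_cone C u"
    using Cb bu by (force simp: normal_cone_def inner_diff_right)
  then have "a \<bullet> w < 0" using w a(1) by blast
  then show False using Rb[of 1] Cb[OF u] by simp
qed

text \<open>Each point of \<open>B\<close> has its own admissible step \<open>s\<close>, which works
  on the open neighbourhood \<open>U s\<close>. Compactness leaves finitely many steps, and
  convexity admits every smaller step.\<close>

lemma inward_field_preserves:
  fixes B C :: "(real ^ 'n) set" and g :: "real ^ 'n \<Rightarrow> real ^ 'n"
  assumes C: "convex C" "interior C \<noteq> {}" and B: "compact B" "B \<subseteq> C"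
    and g: "continuous_on UNIV g"
    and inward: "\<And>u v. u \<in> B \<Longrightarrow> v \<in> normal_cone C u \<Longrightarrow> v \<noteq> 0 \<Longrightarrow> v \<bullet> g u < 0"
  obtains d where "d > 0" "\<And>t x. 0 \<le> t \<Longrightarrow> t \<le> d \<Longrightarrow> x \<in> B \<Longrightarrow> x + t *\<^sub>R g x \<in> C"
proof -
  define U where "U s = (\<lambda>x. x + s *\<^sub>R g x) -` interior C" for s
  have op: "open (U s)" for s
    unfolding U_def using g by (intro open_vimage continuous_intros) auto
  have cov: "B \<subseteq> (\<Union>s\<in>{0<..}. U s)"
  proof
    fix u assume "u \<in> B"
    then obtain s where "s > 0" "u + s *\<^sub>R g u \<in> interior C"
      using inward_direction_hits_interior[OF C, of u "g u"] B inward by blast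
    then show "u \<in> (\<Union>s\<in>{0<..}. U s)" by (auto simp: U_def)
  qed
  obtain F where F: "F \<subseteq> {0<..}" "finite F" "B \<subseteq> (\<Union>s\<in>F. U s)"
    using compactE_image[OF B(1) op cov] by metis
  \<comment> \<open>The inserted 1 keeps the minimum defined when \<open>F\<close> is empty.\<close>
  define d where "d = Min (insert 1 F)"
  show ?thesis
  proof (rule that[of d])
    show "d > 0" using F by (auto simp: d_def)
  next
    fix t x assume t: "0 \<le> t" "t \<le> d" and x: "x \<in> B"
    then obtain s where s: "s \<in> F" "x \<in> U s" using F by auto
    have s0: "s > 0" and ts: "t \<le> s"
      using s F t by (auto simp: d_def)
    have "x + s *\<^sub>R g x \<in> C"
      using s interior_subset by (auto simp: U_def)
    then have "(1 - t / s) *\<^sub>R x + (t / s) *\<^sub>R (x + s *\<^sub>R g x) \<in> C"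
      using C(1) B x t s0 ts by (intro convexD) auto
    also have "(1 - t / s) *\<^sub>R x + (t / s) *\<^sub>R (x + s *\<^sub>R g x) = x + t *\<^sub>R g x"
      using s0 by (simp add: algebra_simps)
    finally show "x + t *\<^sub>R g x \<in> C" .
  qed
qed

section \<open>Determinants and tensors\<close>

text \<open>Differentiate the Leibniz expansion term by term. A permutation other than the identity
  moves at least two points, so after one factor is differentiated an off-diagonal zero of the
  identity matrix remains; only the diagonal term contributes.\<close>

lemma has_real_derivative_det_mat_1:
  fixes A :: "real ^ 'n ^ 'n"
  shows "((\<lambda>t. det (mat 1 + t *\<^sub>R A)) has_real_derivative trace A) (at 0)"
proof -
  define D where "D p = (\<Sum>i\<in>UNIV. A $ i $ p i * (\<Prod>j\<in>UNIV - {i}. (mat 1 :: real ^ 'n ^ 'n) $ j $ p j))"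
    for p :: "'n \<Rightarrow> 'n"
  have D: "((\<lambda>t. \<Prod>i\<in>UNIV. (mat 1 + t *\<^sub>R A) $ i $ p i) has_real_derivative D p) (at 0)" for p
    unfolding D_def
    by (rule has_field_derivative_prod[THEN DERIV_cong])
       (auto intro!: derivative_eq_intros)
  have D0: "D p = 0" if p: "p permutes UNIV" "p \<noteq> id" for p
  proof -
    have "\<exists>j\<in>UNIV - {i}. p j \<noteq> j" for i
    proof (rule ccontr)
      assume "\<not> ?thesis"
      then have fix_j: "p j = j" if "j \<noteq> i" for j using that by auto
      moreover have "p i = i"
        using fix_j permutes_inj[OF p(1)] by (metis injD)
      ultimately show False using p(2) by (metis eq_id_iff)
    qed
    then have "(\<Prod>j\<in>UNIV - {i}. (mat 1 :: real ^ 'n ^ 'n) $ j $ p j) = 0" for i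
      by (auto simp: mat_def intro!: prod_zero) metis
    then show ?thesis by (simp only: D_def mult_zero_right sum.neutral_const)
  qed
  have "((\<lambda>t. det (mat 1 + t *\<^sub>R A)) has_real_derivative
         (\<Sum>p | p permutes UNIV. of_int (sign p) * D p)) (at 0)"
    unfolding det_def by (intro DERIV_sum DERIV_cmult D)
  also have "(\<Sum>p | p permutes UNIV. of_int (sign p) * D p) = (\<Sum>p\<in>{id}. of_int (sign p) * D p)"
    using D0 by (intro sum.mono_neutral_right) (auto simp: permutes_id)
  also have "\<dots> = trace A"
    by (simp add: D_def trace_def mat_def)
  finally show ?thesis .
qed

text \<open>Translates a linear functional on tensors into a linear vector field tested against
  normals; this is where the transpose in the affine field comes from.\<close>

lemma inner_tensor_vec: "A \<bullet> tensor_vec u v = v \<bullet> (transpose A *v u)"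
proof -
  have "A \<bullet> tensor_vec u v = (\<Sum>i\<in>UNIV. \<Sum>j\<in>UNIV. A $ i $ j * (u $ i * v $ j))"
    by (simp add: inner_vec_def tensor_vec_nth)
  also have "\<dots> = (\<Sum>j\<in>UNIV. \<Sum>i\<in>UNIV. A $ i $ j * (u $ i * v $ j))"
    by (rule sum.swap)
  also have "\<dots> = v \<bullet> (transpose A *v u)"
    by (simp add: inner_vec_def matrix_vector_mult_def transpose_def sum_distrib_left algebra_simps)
  finally show ?thesis .
qed

lemma inner_mat_1: "A \<bullet> mat 1 = trace (A :: real ^ 'n ^ 'n)"
  by (simp add: inner_vec_def mat_def trace_def if_distrib cong: if_cong)

lemma tensor_vec_mult_vector: "tensor_vec u v *v w = (v \<bullet> w) *\<^sub>R u"
  by (simp add: vec_eq_iff matrix_vector_mult_def tensor_vec_nth inner_vec_def sum_distrib_left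
      sum_distrib_right algebra_simps)

lemma continuous_on_tensor_vec [continuous_intros]:
  assumes "continuous_on S f" "continuous_on S g"
  shows "continuous_on S (\<lambda>x. tensor_vec (f x) (g x))"
proof -
  have eq: "(\<lambda>x. tensor_vec (f x) (g x)) = (\<lambda>x. \<chi> i j. f x $ i * g x $ j)"
    by (simp add: fun_eq_iff vec_eq_iff tensor_vec_nth)
  show ?thesis
    unfolding eq by (intro continuous_intros assms)
qed

text \<open>The vectors \<open>v k\<close> span, since the identity annihilates anything orthogonal
  to all of them. The second relation expresses one \<open>v k0\<close> through the rest, so the
  other \<open>card K - 1\<close> vectors already span.\<close>

lemma identity_decomposition_card:
  fixes u v :: "'k \<Rightarrow> real ^ 'n"
  assumes K: "finite K" and l: "\<And>k. k \<in> K \<Longrightarrow> l k > 0"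
    and I: "mat 1 = (\<Sum>k\<in>K. l k *\<^sub>R tensor_vec (u k) (v k))" and o: "0 = (\<Sum>k\<in>K. l k *\<^sub>R v k)"
  shows "CARD('n) + 1 \<le> card K"
proof -
  have "K \<noteq> {}"
  proof
    assume "K = {}"
    then have "(mat 1 :: real ^ 'n ^ 'n) = 0" using I by simp
    then have "trace (mat 1 :: real ^ 'n ^ 'n) = 0" by (simp add: trace_def)
    then show False by (simp add: trace_I)
  qed
  then obtain k0 where k0: "k0 \<in> K" by auto
  define V where "V = v ` (K - {k0})"
  have "(\<Sum>k\<in>K. l k *\<^sub>R v k) = l k0 *\<^sub>R v k0 + (\<Sum>k\<in>K - {k0}. l k *\<^sub>R v k)"
    using K k0 by (simp add: sum.remove)
  then have "l k0 *\<^sub>R v k0 = - (\<Sum>k\<in>K - {k0}. l k *\<^sub>R v k)"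
    using o by (metis add_eq_0_iff2)
  also have "\<dots> \<in> span V"
    unfolding V_def by (intro span_neg span_sum span_scale span_base) auto
  finally have "(1 / l k0) *\<^sub>R l k0 *\<^sub>R v k0 \<in> span V"
    by (rule span_scale)
  then have v0: "v k0 \<in> span V"
    using l[OF k0] by simp
  have vk: "v k \<in> span V" if "k \<in> K" for k
    using v0 that by (cases "k = k0") (auto simp: V_def intro: span_base)
  have "span V = UNIV"
  proof (rule ccontr)
    assume "span V \<noteq> UNIV"
    then obtain w where w: "w \<noteq> 0" "\<forall>x\<in>span V. w \<bullet> x = 0"
      using span_not_UNIV_orthogonal by blast
    have "w = mat 1 *v w" by simp
    also have "\<dots> = (\<Sum>k\<in>K. (l k *\<^sub>R tensor_vec (u k) (v k)) *v w)"
      unfolding I using K by (induction K) (auto simp: matrix_vector_mult_add_rdistrib)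
    also have "\<dots> = 0"
      using w vk by (intro sum.neutral)
        (auto simp: tensor_vec_mult_vector inner_commute simp flip: scaleR_matrix_vector_assoc)
    finally show False using w by simp
  qed
  then have "CARD('n) = dim V"
    by (metis dim_UNIV dim_span DIM_cart DIM_real mult.right_neutral)
  also have "\<dots> \<le> card V"
    using K by (intro dim_le_card') (simp add: V_def)
  also have "\<dots> \<le> card (K - {k0})"
    unfolding V_def using K by (intro card_image_le) auto
  also have "\<dots> < card K"
    using K k0 by (meson card_Diff1_less)
  finally show ?thesis by simp
qed

section \<open>Maximal affine images\<close>

text \<open>The library has this only for index types of class \<open>wellorder\<close>.\<close>

lemma measure_linear_image_finite:
  fixes f :: "real ^ 'n \<Rightarrow> real ^ 'n"
  assumes "linear f" "S \<in> lmeasurable"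
  shows "f ` S \<in> lmeasurable \<and> measure lebesgue (f ` S) = \<bar>det (matrix f)\<bar> * measure lebesgue S"
proof -
  define scales where "scales f \<longleftrightarrow> (\<forall>S\<in>lmeasurable. f ` S \<in> lmeasurable \<and>
    measure lebesgue (f ` S) = \<bar>det (matrix f)\<bar> * measure lebesgue S)" for f :: "real ^ 'n \<Rightarrow> real ^ 'n"
  have boxes: "scales f"
    \<comment> \<open>For maps of determinant 1 or -1 it suffices to check that volumes of boxes are
      preserved; this covers coordinate swaps and shears.\<close>
    if "linear f" "\<bar>det (matrix f)\<bar> = 1"
      "\<And>a b. cbox a b \<noteq> {} \<Longrightarrow> measure lebesgue (f ` cbox a b) = measure lebesgue (cbox a b)"
    for f :: "real ^ 'n \<Rightarrow> real ^ 'n"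
  proof -
    have "measure lebesgue (f ` cbox a b) = 1 * measure lebesgue (cbox a b)" for a b
      using that(3)[of a b] by (cases "cbox a b = {}") auto
    from measure_linear_sufficient[OF that(1) _ this] show ?thesis
      unfolding scales_def that(2) by metis
  qed
  have "scales f"
    using assms(1)
  proof (rule induct_linear_elementary)
    fix f g :: "real ^ 'n \<Rightarrow> real ^ 'n"
    assume "linear f" "linear g" "scales f" "scales g"
    then show "scales (f \<circ> g)"
      unfolding scales_def image_comp[symmetric] by (simp add: matrix_compose det_mul abs_mult)
  next
    fix f :: "real ^ 'n \<Rightarrow> real ^ 'n" and i
    assume f: "linear f" "\<And>x. f x $ i = 0"
    have "axis i 1 \<notin> range f"
      using f(2) by (metis axis_nth rangeE zero_neq_one)
    then have ninj: "\<not> inj f"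
      using linear_injective_imp_surjective[OF f(1)] by blast
    then have "negligible (f ` S)" for S
      by (rule negligible_linear_singular_image[OF f(1)])
    moreover have "det (matrix f) = 0"
      using ninj det_nz_iff_inj[OF f(1)] by blast
    ultimately show "scales f"
      by (simp add: scales_def negligible_iff_measure)
  next
    fix c :: "'n \<Rightarrow> real"
    show "scales (\<lambda>x. \<chi> i. c i * x $ i)"
      by (simp add: scales_def measurable_stretch measure_stretch matrix_def axis_def det_diagonal)
  next
    fix m n :: 'n
    let ?\<tau> = "Transposition.transpose m n"
    let ?f = "\<lambda>x :: real ^ 'n. \<chi> i. x $ ?\<tau> i"
    have lin: "linear ?f"
      by (rule linearI) (simp_all add: vec_eq_iff)
    have "?f \<circ> ?f = id"
      by (simp add: fun_eq_iff vec_eq_iff)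
    then have "matrix ?f ** matrix ?f = mat 1"
      using matrix_compose[OF lin lin] by (simp add: matrix_id_mat_1)
    then have "det (matrix ?f) * det (matrix ?f) = 1"
      by (metis det_mul det_I)
    then have det: "\<bar>det (matrix ?f)\<bar> = 1"
      by (metis abs_square_eq_1 power2_eq_square)
    show "scales ?f"
    proof (rule boxes[OF lin det])
      fix a b :: "real ^ 'n" assume ne: "cbox a b \<noteq> {}"
      have "y \<in> ?f ` cbox a b" if "y \<in> cbox (?f a) (?f b)" for y
      proof (rule image_eqI[of _ _ "?f y"])
        have "a $ ?\<tau> (?\<tau> i) \<le> y $ ?\<tau> i \<and> y $ ?\<tau> i \<le> b $ ?\<tau> (?\<tau> i)" for i
          using that unfolding mem_box_cart by (metis vec_lambda_beta)
        then show "?f y \<in> cbox a b"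
          unfolding mem_box_cart by simp
      qed (simp add: vec_eq_iff)
      then have eq: "?f ` cbox a b = cbox (?f a) (?f b)"
        by (auto simp: mem_box_cart)
      have "(\<Prod>i\<in>UNIV. b $ ?\<tau> i - a $ ?\<tau> i) = (\<Prod>i\<in>UNIV. b $ i - a $ i)"
        by (rule prod.reindex_bij_betw) simp
      moreover have "cbox (?f a) (?f b) \<noteq> {}"
        using ne by (simp flip: eq)
      ultimately show "measure lebesgue (?f ` cbox a b) = measure lebesgue (cbox a b)"
        using ne by (simp add: eq content_cbox_if_cart)
    qed
  next
    fix m n :: 'n assume mn: "m \<noteq> n"
    let ?f = "\<lambda>x :: real ^ 'n. \<chi> i. if i = m then x $ m + x $ n else x $ i"
    have lin: "linear ?f"
      by (rule linearI) (auto simp: vec_eq_iff algebra_simps)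
    have "matrix ?f = (\<chi> k. if k = m then row m (mat 1) + 1 *s row n (mat 1) else row k (mat 1))"
      by (auto simp: vec_eq_iff matrix_def axis_def row_def mat_def)
    then have det: "\<bar>det (matrix ?f)\<bar> = 1"
      using det_row_operation[OF mn, of "mat 1 :: real ^ 'n ^ 'n" 1] by simp
    show "scales ?f"
    proof (rule boxes[OF lin det])
      fix a b :: "real ^ 'n" assume ne: "cbox a b \<noteq> {}"
      \<comment> \<open>The shear formula for boxes asks for a nonnegative \<open>n\<close>-th
        coordinate of the lower corner; this translation makes it 0 and changes no measure.\<close>
      define z where "z = axis n (- (a $ n))"
      have box: "(+) z ` cbox a b = cbox (z + a) (z + b)"
        by (rule cbox_translation[symmetric])
      have img: "?f ` (+) z ` cbox a b = (+) (?f z) ` ?f ` cbox a b"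
        unfolding image_image by (simp only: linear_add[OF lin])
      have "measure lebesgue (?f ` cbox a b) = measure lebesgue (?f ` cbox (z + a) (z + b))"
        unfolding box[symmetric] img measure_translation ..
      also have "\<dots> = measure lebesgue (cbox (z + a) (z + b))"
      proof (rule measure_shear_interval[OF mn])
        show "cbox (z + a) (z + b) \<noteq> {}" using ne by (simp flip: box)
        show "0 \<le> (z + a) $ n" by (simp add: z_def)
      qed
      also have "\<dots> = measure lebesgue (cbox a b)"
        unfolding box[symmetric] measure_translation ..
      finally show "measure lebesgue (?f ` cbox a b) = measure lebesgue (cbox a b)" .
    qed
  qed
  then show ?thesis using assms(2) unfolding scales_def by blast
qed

lemma measure_affine_image:
  fixes B :: "(real ^ 'n) set"
  assumes "B \<in> lmeasurable"
  shows "measure lebesgue ((\<lambda>x. M *v x + a) ` B) = \<bar>det M\<bar> * measure lebesgue B"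
proof -
  have "(\<lambda>x. M *v x + a) ` B = (+) a ` ((*v) M ` B)"
    by (auto simp: image_image add.commute)
  then show ?thesis
    using measure_linear_image_finite[of "(*v) M" B] assms by (simp add: measure_translation)
qed

text \<open>The first-order form of maximality: the trace is the initial rate of volume growth along
  \<open>x + t *\<^sub>R (A *v x + b)\<close>, and an inward field keeps these images of
  \<open>B\<close> in \<open>C\<close> for small \<open>t\<close>.\<close>

lemma no_inward_affine_field:
  fixes B C :: "(real ^ 'n) set" and A :: "real ^ 'n ^ 'n"
  assumes C: "convex C" "interior C \<noteq> {}" and B: "compact B" "B \<subseteq> C" "measure lebesgue B > 0"
    and max: "\<forall>B' \<in> affine_images B. B' \<subseteq> C \<longrightarrow> measure lebesgue B' \<le> measure lebesgue B"
    and inward: "\<And>u v. u \<in> B \<Longrightarrow> v \<in> normal_cone C u \<Longrightarrow> v \<noteq> 0 \<Longrightarrow> v \<bullet> (A *v u + b) < 0"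
  shows "trace A \<le> 0"
proof (rule ccontr)
  assume "\<not> trace A \<le> 0"
  then obtain e where e: "e > 0" "\<And>t. 0 < t \<Longrightarrow> t < e \<Longrightarrow> 1 < det (mat 1 + t *\<^sub>R A)"
    using DERIV_pos_inc_right[OF has_real_derivative_det_mat_1[of A]] by auto
  have "continuous_on UNIV (\<lambda>x. A *v x + b)"
    by (intro continuous_intros matrix_vector_mult_linear_continuous_on)
  then obtain d where d: "d > 0" "\<And>t x. 0 \<le> t \<Longrightarrow> t \<le> d \<Longrightarrow> x \<in> B \<Longrightarrow> x + t *\<^sub>R (A *v x + b) \<in> C"
    using inward_field_preserves[OF C B(1,2), of "\<lambda>x. A *v x + b"] inward by blast
  define t where "t = min d (e / 2)"
  have t: "0 < t" "t \<le> d" "t < e" using d e by (auto simp: t_def min_def)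
  define M where "M = mat 1 + t *\<^sub>R A"
  have det: "1 < det M" using e t by (simp add: M_def)
  define B' where "B' = (\<lambda>x. M *v x + t *\<^sub>R b) ` B"
  have "invertible M" using det by (simp add: invertible_det_nz)
  then have "B' \<in> affine_images B" by (auto simp: affine_images_def B'_def)
  moreover have "M *v x + t *\<^sub>R b = x + t *\<^sub>R (A *v x + b)" for x
    by (simp add: M_def matrix_vector_mult_add_rdistrib scaleR_add_right
        flip: scaleR_matrix_vector_assoc)
  then have "B' \<subseteq> C"
    using d t by (auto simp: B'_def)
  ultimately have "measure lebesgue B' \<le> measure lebesgue B" using max by blast
  moreover have "measure lebesgue B' = det M * measure lebesgue B"
    unfolding B'_def using det by (simp add: measure_affine_image lmeasurable_compact B)
  ultimately show False using det B(3) by simp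
qed

text \<open>Normality is a family of closed conditions on the pair \<open>(u, v)\<close>, one for
  each point of \<open>C\<close>; fixing the norm of \<open>v\<close> makes the set bounded.\<close>

lemma compact_unit_normal_pairs:
  fixes B C :: "(real ^ 'n) set"
  assumes "compact B"
  shows "compact {(u, v). u \<in> B \<and> v \<in> normal_cone C u \<and> norm v = 1}"
proof -
  have "{(u, v). u \<in> B \<and> v \<in> normal_cone C u \<and> norm v = 1} =
        (B \<times> sphere 0 1) \<inter> (\<Inter>x\<in>C. {p. snd p \<bullet> (x - fst p) \<le> 0})"
    by (auto simp: normal_cone_def)
  moreover have "closed (\<Inter>x\<in>C. {p::(real ^ 'n) \<times> (real ^ 'n). snd p \<bullet> (x - fst p) \<le> 0})"
    by (intro closed_INT ballI closed_Collect_le continuous_intros)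
  ultimately show ?thesis
    using assms by (simp add: compact_Int_closed compact_Times)
qed

theorem theorem3:
  fixes B C :: "(real ^ 'n) set"
  assumes "compact C" and "convex C"
    and "B \<subseteq> C" and "compact B" and "measure lebesgue B > 0"
    and "\<forall>B' \<in> affine_images B. B' \<subseteq> C \<longrightarrow> measure lebesgue B' \<le> measure lebesgue B"
  shows "\<exists>(n::nat) (u :: nat \<Rightarrow> real ^ 'n) (v :: nat \<Rightarrow> real ^ 'n) (l :: nat \<Rightarrow> real).
           CARD('n) + 1 \<le> n \<and> n \<le> CARD('n) * (CARD('n) + 1) \<and>
           (\<forall>k\<in>{1..n}. u k \<in> B \<inter> frontier C \<and> v k \<in> normal_cone C (u k) \<and> l k > 0) \<and>
           mat 1 = (\<Sum>k = 1..n. l k *\<^sub>R tensor_vec (u k) (v k)) \<and>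
           0 = (\<Sum>k = 1..n. l k *\<^sub>R v k)"
proof -
  have "\<not> negligible C"
  proof
    assume "negligible C"
    then have "negligible B" using assms(3) negligible_subset by blast
    then show False using assms(5) negligible_imp_measure0 by force
  qed
  then have int: "interior C \<noteq> {}"
    using negligible_convex_interior assms(2) by blast
  then obtain p where p: "p \<in> interior C" by auto
  define P where "P = {(u, v). u \<in> B \<and> v \<in> normal_cone C u \<and> norm v = 1}"
  define f where "f = (\<lambda>(u, v :: real ^ 'n). (tensor_vec u v, v))"
  define S where "S = f ` P"
  have "compact S"
    unfolding S_def f_def case_prod_unfold P_def
    by (intro compact_continuous_image continuous_intros compact_unit_normal_pairs[unfolded case_prod_unfold] assms(4))
  moreover have "0 \<notin> convex hull S"
  proof -
    \<comment> \<open>The value is \<open>v \<bullet> (u - p)\<close>, positive because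
      \<open>p\<close> is interior. So one open half-space with 0 on its boundary contains all
      generators.\<close>
    have "(mat 1, - p) \<bullet> f (u, v) > 0" if "(u, v) \<in> P" for u v
    proof -
      have "v \<bullet> (p - u) < 0"
        using that p by (intro normal_cone_interior_less) (auto simp: P_def)
      then show ?thesis
        by (simp add: f_def inner_tensor_vec inner_diff_right inner_commute)
    qed
    then have "convex hull S \<subseteq> {x. (mat 1, - p) \<bullet> x > 0}"
      by (intro hull_minimal convex_halfspace_gt) (auto simp: S_def)
    then show ?thesis by auto
  qed
  moreover have "(mat 1 :: real ^ 'n ^ 'n, 0 :: real ^ 'n) \<noteq> 0"
    by (auto simp: vec_eq_iff mat_def zero_prod_def)
  ultimately obtain T c where T: "finite T" "T \<subseteq> S" "\<And>x. x \<in> T \<Longrightarrow> 0 \<le> c x"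
    "(\<Sum>x\<in>T. c x *\<^sub>R x) = (mat 1 :: real ^ 'n ^ 'n, 0 :: real ^ 'n)"
  proof (cases rule: compact_cone_alternative)
    case (cone T c)
    then show ?thesis by (rule that)
  next
    case (separated a)
    obtain A b where a: "a = (A, b)" by (cases a)
    have "v \<bullet> (transpose A *v u + b) < 0"
      if "u \<in> B" "v \<in> normal_cone C u" "v \<noteq> 0" for u v
    proof -
      \<comment> \<open>Separation speaks of unit normals only; rescaling gives all nonzero
        ones.\<close>
      have "(u, v /\<^sub>R norm v) \<in> P"
        using that by (auto simp: P_def normal_cone_def mult_nonneg_nonpos)
      then have "a \<bullet> f (u, v /\<^sub>R norm v) < 0"
        using separated(2) by (auto simp: S_def)
      then have "(v \<bullet> (transpose A *v u + b)) / norm v < 0"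
        by (simp add: a f_def inner_tensor_vec inner_add_right inner_commute add_divide_distrib
            divide_inverse_commute distrib_left)
      then show ?thesis using that(3) by (simp add: divide_less_0_iff)
    qed
    then have "trace (transpose A) \<le> 0"
      using no_inward_affine_field[OF assms(2) int assms(4,3,5,6)] by blast
    moreover have "trace (transpose A) = a \<bullet> (mat 1, 0)"
      by (simp add: a inner_mat_1 trace_def transpose_def)
    ultimately show ?thesis using separated(1) by simp
  qed
  have "\<exists>Q b. Q \<subseteq> T \<and> independent Q \<and> (\<forall>x\<in>Q. 0 < b x)
          \<and> (\<Sum>x\<in>Q. b x *\<^sub>R x) = (\<Sum>x\<in>T. c x *\<^sub>R x)"
    by (rule positive_combination_independent[OF T(1)]) (rule T(3))
  then obtain Q b where Q: "Q \<subseteq> T" "independent Q" "\<forall>x\<in>Q. 0 < b x"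
    and sum: "(\<Sum>x\<in>Q. b x *\<^sub>R x) = (mat 1 :: real ^ 'n ^ 'n, 0 :: real ^ 'n)"
    unfolding T(4) by (elim exE conjE)
  define n where "n = card Q"
  have "finite Q" using finite_subset[OF Q(1) T(1)] .
  then obtain h where h: "bij_betw h {1..n} Q"
    unfolding n_def using ex_bij_betw_nat_finite_1 by blast
  have hQ: "h k \<in> Q" if "k \<in> {1..n}" for k
    using h that bij_betwE by blast
  \<comment> \<open>Each of the \<open>n\<close> chosen generators is lifted to a pair of a point
    and a unit normal.\<close>
  then have "\<forall>k\<in>{1..n}. \<exists>q. q \<in> P \<and> h k = f q"
    using Q T by (force simp: S_def)
  then obtain q where q: "\<And>k. k \<in> {1..n} \<Longrightarrow> q k \<in> P" "\<And>k. k \<in> {1..n} \<Longrightarrow> h k = f (q k)"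
    by metis
  define u v l where "u k = fst (q k)" and "v k = snd (q k)" and "l k = b (h k)" for k
  have hk: "h k = (tensor_vec (u k) (v k), v k)" if "k \<in> {1..n}" for k
    using q(2)[OF that] by (simp add: f_def u_def v_def case_prod_unfold)
  have uv: "u k \<in> B \<inter> frontier C \<and> v k \<in> normal_cone C (u k) \<and> l k > 0" if "k \<in> {1..n}" for k
  proof -
    have "u k \<in> B" "v k \<in> normal_cone C (u k)" "norm (v k) = 1"
      using q(1)[OF that] by (auto simp: P_def u_def v_def)
    moreover from this have "u k \<in> frontier C"
      using assms(3) by (intro normal_cone_frontier[of "v k"]) auto
    ultimately show ?thesis
      using Q(3) hQ[OF that] by (simp add: l_def)
  qed
  have "(mat 1, 0) = (\<Sum>k = 1..n. l k *\<^sub>R h k)"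
    unfolding l_def sum[symmetric] by (rule sum.reindex_bij_betw[OF h, symmetric])
  also have "\<dots> = (\<Sum>k = 1..n. (l k *\<^sub>R tensor_vec (u k) (v k), l k *\<^sub>R v k))"
    by (intro sum.cong) (auto simp: hk)
  also have "\<dots> = (\<Sum>k = 1..n. l k *\<^sub>R tensor_vec (u k) (v k), \<Sum>k = 1..n. l k *\<^sub>R v k)"
    by (simp add: sum_prod)
  finally have I: "mat 1 = (\<Sum>k = 1..n. l k *\<^sub>R tensor_vec (u k) (v k))"
    and o: "0 = (\<Sum>k = 1..n. l k *\<^sub>R v k)"
    by auto
  have "CARD('n) + 1 \<le> n"
    using identity_decomposition_card[OF _ _ I o] uv by auto
  \<comment> \<open>Independent generators number at most the dimension of the space of
    matrix-vector pairs, which is \<open>d * d + d\<close> for \<open>d = CARD('n)\<close>.\<close>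
  moreover have "n \<le> DIM((real ^ 'n ^ 'n) \<times> (real ^ 'n))"
    unfolding n_def using Q(2) independent_bound by blast
  then have "n \<le> CARD('n) * (CARD('n) + 1)"
    by (simp add: algebra_simps)
  ultimately show ?thesis
    using uv I o by blast
qed

end
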